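(* If $L=L_1+\dots+L_m$ (Minkowski sum) where $L_1,\dots,L_m\subset\mathbb{R}^n$ are non-singleton (nonempty) compact convex sets, then $$\rho_\Delta(L)\le\max\{\rho_\Delta(L_j):j\in[m]\},$$ where $\Delta=\Delta^n$ is the standard regular $n$-simplex.
   Context: $\Delta=\Delta^n\subset\mathbb{R}^n$ is the regular simplex obtained by orthogonally projecting $\mathsf{conv}\{e_1,\dots,e_{n+1}\}\subset\mathbb{R}^{n+1}$ to the hyperplane orthogonal to $(1,\dots,1)$ (identified isometrically with $\mathbb{R}^n$). For compact convex $K,L\subset\mathbb{R}^n$, $\lambda_K(L):=\inf\{\lambda\ge 0:\exists x\in\mathbb{R}^n,\ L\subset x+\lambda K\}$. For a compact convex $L$ that is not a point, $\rho_\Delta(L):=\lambda_{-\Delta}(L)/\lambda_\Delta(L)$. $[m]=\{1,\dots,m\}$, $m\ge 1$. *)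

theory Defs
  imports "HOL-Analysis.Analysis" "HOL-Library.Set_Algebras"
begin

text \<open>
  \<open>\<real>\<^sup>n\<close> is \<open>real ^ 'n\<close>, and \<open>\<real>\<^sup>n\<^sup>+\<^sup>1\<close> is \<open>real ^ 'n option\<close>, since the index type
  \<open>'n option\<close> has one element more than \<open>'n\<close>. In both spaces \<open>1\<close> is the all-ones vector.
\<close>

definition sum_zero_hyperplane :: "(real ^ 'm) set" where
  "sum_zero_hyperplane = {x. 1 \<bullet> x = 0}"

definition proj_sum_zero :: "real ^ 'm \<Rightarrow> real ^ 'm" where
  "proj_sum_zero x = x - ((x \<bullet> 1) / (1 \<bullet> (1 :: real ^ 'm))) *\<^sub>R 1"

lemma proj_sum_zero_orthogonal:
  "proj_sum_zero x \<in> sum_zero_hyperplane"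
  "y \<in> sum_zero_hyperplane \<Longrightarrow> (x - proj_sum_zero x) \<bullet> y = 0"
  by (auto simp: proj_sum_zero_def sum_zero_hyperplane_def inner_diff_right inner_commute)

definition hyperplane_identification :: "(real ^ 'n \<Rightarrow> real ^ 'n option) \<Rightarrow> bool" where
  "hyperplane_identification \<iota> \<longleftrightarrow>
     linear \<iota> \<and> (\<forall>x. norm (\<iota> x) = norm x) \<and> range \<iota> = sum_zero_hyperplane"

definition regular_simplex :: "(real ^ 'n \<Rightarrow> real ^ 'n option) \<Rightarrow> (real ^ 'n) set" where
  "regular_simplex \<iota> =
     \<iota> -` (proj_sum_zero ` (convex hull (range (\<lambda>i. axis i 1))))"

lemma hyperplane_identification_exists:
  "\<exists>\<iota> :: real ^ 'n \<Rightarrow> real ^ 'n option. hyperplane_identification \<iota>"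
proof -
  let ?H = "{x :: real ^ 'n option. 1 \<bullet> x = 0}"
  have "(1 :: real ^ 'n option) \<noteq> 0"
    by (simp add: vec_eq_iff)
  then have "dim ?H = DIM(real ^ 'n option) - 1"
    by (rule dim_hyperplane)
  then have "dim (UNIV :: (real ^ 'n) set) = dim ?H"
    by simp
  then obtain f :: "real ^ 'n \<Rightarrow> real ^ 'n option" where
    "linear f" "f ` UNIV = ?H" "\<And>x. x \<in> UNIV \<Longrightarrow> norm (f x) = norm x"
    by (rule isometries_subspaces[OF subspace_UNIV subspace_hyperplane]) blast
  then show ?thesis
    unfolding hyperplane_identification_def sum_zero_hyperplane_def by blast
qed

text \<open>
  The infimum is taken in \<open>real\<close>, so it has its intended meaning only when some homothet of \<open>K\<close>
  covers \<open>L\<close>; this is the case for every bounded \<open>L\<close> if \<open>K\<close> has nonempty interior.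
\<close>

definition cover_factor :: "'a::real_vector set \<Rightarrow> 'a set \<Rightarrow> real" where
  "cover_factor K L = Inf {r. r \<ge> 0 \<and> (\<exists>x. L \<subseteq> (\<lambda>y. x + r *\<^sub>R y) ` K)}"

definition cover_ratio :: "'a::real_vector set \<Rightarrow> 'a set \<Rightarrow> real" where
  "cover_ratio K L = cover_factor (uminus ` K) L / cover_factor K L"

end

theory Submission
  imports Defs
begin

text \<open>
  In barycentric coordinates a homothet \<open>x + r \<Delta>\<close> is cut out by the lower bounds
  \<open>\<iota> y $ i \<ge> \<iota> x $ i - r / (n + 1)\<close> alone. A homothet containing \<open>L\<close> must respect the infimum of
  each coordinate on \<open>L\<close>; since the coordinates of \<open>\<iota> x\<close> add up to zero, summing the
  bounds leaves a condition on \<open>r\<close> alone, and it is sufficient because \<open>x\<close> can be chosen to make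
  every bound tight. So the covering factor of \<open>L\<close> by \<open>\<Delta>\<close> is \<open>- (\<Sum>i. inf\<^bsub>y\<in>L\<^esub> \<iota> y $ i)\<close>
  (\<open>cover_factor_regular_simplex\<close>), a sum of support function values.

  Infima of linear functionals are additive under Minkowski sums; hence so is the covering factor
  (\<open>cover_factor_regular_simplex_sum\<close>), and, by reflecting \<open>L\<close> instead of \<open>\<Delta>\<close>, so is the covering
  factor by \<open>- \<Delta>\<close>. Therefore \<open>\<rho>\<^sub>\<Delta>(L)\<close> is the quotient of the sum of the numerators by the sum of the
  denominators of the \<open>\<rho>\<^sub>\<Delta>(L\<^sub>j)\<close>. The denominators are positive for sets with more than one point,
  so this mediant cannot exceed the largest of the quotients.
\<close>

section \<open>Barycentric description of the simplex\<close>

lemma convex_hull_range_axis: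
  "convex hull (range (\<lambda>i. axis i 1)) = {x :: real ^ 'm. (\<forall>i. 0 \<le> x $ i) \<and> (\<Sum>i\<in>UNIV. x $ i) = 1}"
    (is "?H = ?S")
proof
  have "convex ?S"
    by (auto simp: convex_def sum.distrib simp flip: sum_distrib_left)
  moreover have "range (\<lambda>i. axis i 1) \<subseteq> ?S"
    by (auto simp: axis_def)
  ultimately show "?H \<subseteq> ?S"
    by (rule hull_minimal[rotated])
next
  show "?S \<subseteq> ?H"
  proof
    fix x assume "x \<in> ?S"
    then have "(\<Sum>i\<in>UNIV. x $ i *\<^sub>R (axis i 1 :: real ^ 'm)) \<in> ?H"
      by (intro convex_sum) (auto intro: hull_inc)
    then show "x \<in> ?H"
      using basis_expansion[of x] by (simp add: scalar_mult_eq_scaleR)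
  qed
qed

lemma hyperplane_identification_sum_zero:
  assumes "hyperplane_identification \<iota>"
  shows "(\<Sum>i\<in>UNIV. \<iota> x $ i) = 0"
proof -
  have "\<iota> x \<in> sum_zero_hyperplane"
    using assms by (auto simp: hyperplane_identification_def)
  then show ?thesis
    by (simp add: sum_zero_hyperplane_def inner_vec_def)
qed

lemma hyperplane_identification_inj:
  assumes "hyperplane_identification \<iota>" "\<iota> x = \<iota> y"
  shows "x = y"
proof -
  have "norm (x - y) = norm (\<iota> (x - y))"
    using assms(1) by (simp add: hyperplane_identification_def)
  also have "\<iota> (x - y) = \<iota> x - \<iota> y"
    using assms(1) by (simp add: hyperplane_identification_def linear_diff)
  finally show ?thesis
    using assms(2) by simp
qed

lemma mem_regular_simplex_iff:
  fixes \<iota> :: "real ^ 'n \<Rightarrow> real ^ 'n option"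
  assumes "hyperplane_identification \<iota>"
  shows "y \<in> regular_simplex \<iota> \<longleftrightarrow> (\<forall>i. - 1 / real CARD('n option) \<le> \<iota> y $ i)"
proof
  assume "y \<in> regular_simplex \<iota>"
  then obtain p where p: "\<forall>i. 0 \<le> p $ i" "(\<Sum>i\<in>UNIV. p $ i) = 1" "\<iota> y = proj_sum_zero p"
    by (auto simp: regular_simplex_def convex_hull_range_axis)
  then show "\<forall>i. - 1 / real CARD('n option) \<le> \<iota> y $ i"
    by (simp add: proj_sum_zero_def inner_vec_def)
next
  assume bound: "\<forall>i. - 1 / real CARD('n option) \<le> \<iota> y $ i"
  define p where "p = \<iota> y + (1 / real CARD('n option)) *\<^sub>R 1"
  have sum: "(\<Sum>i\<in>UNIV. p $ i) = 1"
    using hyperplane_identification_sum_zero[OF assms, of y]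
    by (simp add: p_def sum.distrib)
  have "0 \<le> p $ i" for i
    using spec[OF bound, of i] by (simp add: p_def)
  with sum have "p \<in> convex hull (range (\<lambda>i. axis i 1))"
    by (simp add: convex_hull_range_axis)
  moreover have "\<iota> y = proj_sum_zero p"
    using sum by (simp add: proj_sum_zero_def inner_vec_def) (simp add: p_def)
  ultimately show "y \<in> regular_simplex \<iota>"
    by (auto simp: regular_simplex_def)
qed

text \<open>
  For \<open>r > 0\<close> this is a change of variables. The case \<open>r = 0\<close> has to be included because the covering
  factor ranges over all \<open>r \<ge> 0\<close>; there the right-hand side still singles out \<open>x\<close>.
\<close>

lemma mem_homothet_regular_simplex_iff:
  fixes \<iota> :: "real ^ 'n \<Rightarrow> real ^ 'n option"
  assumes \<iota>: "hyperplane_identification \<iota>" and "r \<ge> 0"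
  shows "y \<in> (\<lambda>z. x + r *\<^sub>R z) ` regular_simplex \<iota> \<longleftrightarrow>
           (\<forall>i. \<iota> x $ i - r / real CARD('n option) \<le> \<iota> y $ i)"
proof -
  have lin: "linear \<iota>"
    using \<iota> by (simp add: hyperplane_identification_def)
  show ?thesis
  proof (cases "r = 0")
    case True
    have "0 \<in> regular_simplex \<iota>"
      using lin by (simp add: mem_regular_simplex_iff[OF \<iota>] linear_0)
    then have "y \<in> (\<lambda>z. x + r *\<^sub>R z) ` regular_simplex \<iota> \<longleftrightarrow> y = x"
      using True by auto
    also have "\<dots> \<longleftrightarrow> (\<forall>i. \<iota> x $ i \<le> \<iota> y $ i)"
    proof
      assume le: "\<forall>i. \<iota> x $ i \<le> \<iota> y $ i"
      \<comment> \<open>both coordinate vectors have sum zero, so no inequality can be strict\<close>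
      have "(\<Sum>i\<in>UNIV. \<iota> y $ i - \<iota> x $ i) = 0"
        by (simp add: sum_subtractf hyperplane_identification_sum_zero[OF \<iota>])
      then have "\<forall>i\<in>UNIV. \<iota> y $ i - \<iota> x $ i = 0"
        using le by (subst (asm) sum_nonneg_eq_0_iff) auto
      then have "\<iota> y = \<iota> x"
        by (simp add: vec_eq_iff)
      then show "y = x"
        by (rule hyperplane_identification_inj[OF \<iota>])
    qed simp
    finally show ?thesis
      using True by simp
  next
    case False
    then have r: "r > 0"
      using \<open>r \<ge> 0\<close> by simp
    have "y \<in> (\<lambda>z. x + r *\<^sub>R z) ` regular_simplex \<iota> \<longleftrightarrow> (1 / r) *\<^sub>R (y - x) \<in> regular_simplex \<iota>"
    proof
      assume "(1 / r) *\<^sub>R (y - x) \<in> regular_simplex \<iota>"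
      then show "y \<in> (\<lambda>z. x + r *\<^sub>R z) ` regular_simplex \<iota>"
        by (rule rev_image_eqI) (use r in simp)
    qed (use r in auto)
    also have "\<dots> \<longleftrightarrow> (\<forall>i. \<iota> x $ i - r / real CARD('n option) \<le> \<iota> y $ i)"
      unfolding mem_regular_simplex_iff[OF \<iota>]
      using r by (simp add: lin linear_scale linear_diff field_simps del: card_option)
    finally show ?thesis .
  qed
qed

section \<open>The covering factor as a sum of support values\<close>

lemma bdd_below_linear_coordinate_image:
  fixes f :: "real ^ 'n \<Rightarrow> real ^ 'm"
  assumes "linear f" "bounded L"
  shows "bdd_below ((\<lambda>y. f y $ i) ` L)"
proof -
  have "bounded_linear (\<lambda>y. f y $ i)"
    using assms(1) by (intro bounded_linear_compose[OF bounded_linear_vec_nth])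
      (simp add: linear_conv_bounded_linear)
  with assms(2) show ?thesis
    by (intro bounded_imp_bdd_below bounded_linear_image)
qed

text \<open>
  Summing the coordinate bounds for a covering homothet eliminates its centre and gives the lower
  bound for the factor. Conversely, the coordinates of the optimal centre are the infima, all shifted
  by the same amount so that they add up to zero.
\<close>

lemma cover_factor_regular_simplex:
  fixes \<iota> :: "real ^ 'n \<Rightarrow> real ^ 'n option"
  assumes \<iota>: "hyperplane_identification \<iota>" and "L \<noteq> {}" "bounded L"
  shows "cover_factor (regular_simplex \<iota>) L = - (\<Sum>i\<in>UNIV. INF y\<in>L. \<iota> y $ i)"
proof -
  define low where "low i = (INF y\<in>L. \<iota> y $ i)" for i
  define s where "s = - (\<Sum>i\<in>UNIV. low i)"
  let ?N = "real CARD('n option)"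
  note sum_zero = hyperplane_identification_sum_zero[OF \<iota>]
  have lin: "linear \<iota>"
    using \<iota> by (simp add: hyperplane_identification_def)
  have low_le: "low i \<le> \<iota> y $ i" if "y \<in> L" for y i
    unfolding low_def
    by (intro cINF_lower bdd_below_linear_coordinate_image lin assms that)
  have low_ge: "c \<le> low i" if "\<And>y. y \<in> L \<Longrightarrow> c \<le> \<iota> y $ i" for c i
    unfolding low_def by (intro cINF_greatest assms that)
  obtain y0 where "y0 \<in> L"
    using assms by blast
  then have "(\<Sum>i\<in>UNIV. low i) \<le> (\<Sum>i\<in>UNIV. \<iota> y0 $ i)"
    by (intro sum_mono low_le)
  then have s: "s \<ge> 0"
    by (simp add: s_def sum_zero)
  have "{r. r \<ge> 0 \<and> (\<exists>x. L \<subseteq> (\<lambda>y. x + r *\<^sub>R y) ` regular_simplex \<iota>)} = {s..}"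
  proof (intro equalityI subsetI)
    fix r assume "r \<in> {r. r \<ge> 0 \<and> (\<exists>x. L \<subseteq> (\<lambda>y. x + r *\<^sub>R y) ` regular_simplex \<iota>)}"
    then obtain x where r: "r \<ge> 0" "L \<subseteq> (\<lambda>y. x + r *\<^sub>R y) ` regular_simplex \<iota>"
      by blast
    then have "\<iota> x $ i - r / ?N \<le> low i" for i
      by (intro low_ge) (use mem_homothet_regular_simplex_iff[OF \<iota> r(1)] in blast)
    then have "(\<Sum>i\<in>UNIV. \<iota> x $ i - r / ?N) \<le> (\<Sum>i\<in>UNIV. low i)"
      by (intro sum_mono)
    then show "r \<in> {s..}"
      by (simp add: sum_subtractf sum_zero s_def del: card_option)
  next
    fix r assume "r \<in> {s..}"
    define c where "c = (\<chi> i. low i + s / ?N)"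
    have "(\<Sum>i\<in>UNIV. c $ i) = (\<Sum>i\<in>UNIV. low i) + s"
      by (simp add: c_def sum.distrib del: card_option)
    then have "c \<in> sum_zero_hyperplane"
      by (simp add: s_def sum_zero_hyperplane_def inner_vec_def)
    then obtain x where x: "\<iota> x = c"
      using \<iota> unfolding hyperplane_identification_def by (metis imageE)
    have "s / ?N \<le> r / ?N"
      using \<open>r \<in> {s..}\<close> by (intro divide_right_mono) auto
    then have "\<iota> x $ i - r / ?N \<le> \<iota> y $ i" if "y \<in> L" for y i
      using low_le[OF that, of i] by (simp add: x c_def)
    moreover have "r \<ge> 0"
      using s \<open>r \<in> {s..}\<close> by simp
    ultimately show "r \<in> {r. r \<ge> 0 \<and> (\<exists>x. L \<subseteq> (\<lambda>y. x + r *\<^sub>R y) ` regular_simplex \<iota>)}"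
      using mem_homothet_regular_simplex_iff[OF \<iota>] by blast
  qed
  then show ?thesis
    by (simp add: cover_factor_def s_def low_def)
qed

text \<open>
  The sum of the infima is at most the coordinate sum \<open>0\<close> of any point of \<open>L\<close>, and a second point of
  \<open>L\<close> has some smaller coordinate, which makes the inequality strict.
\<close>

lemma cover_factor_regular_simplex_pos:
  fixes \<iota> :: "real ^ 'n \<Rightarrow> real ^ 'n option"
  assumes \<iota>: "hyperplane_identification \<iota>" and "L \<noteq> {}" "bounded L" "\<not> is_singleton L"
  shows "cover_factor (regular_simplex \<iota>) L > 0"
proof -
  have lin: "linear \<iota>"
    using \<iota> by (simp add: hyperplane_identification_def)
  note sum_zero = hyperplane_identification_sum_zero[OF \<iota>]
  have low_le: "(INF y\<in>L. \<iota> y $ i) \<le> \<iota> y $ i" if "y \<in> L" for y i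
    by (intro cINF_lower bdd_below_linear_coordinate_image lin assms that)
  obtain y where "y \<in> L"
    using assms(2) by blast
  moreover have "L \<noteq> {y}"
    using assms(4) by (auto simp: is_singleton_def)
  ultimately obtain z where yz: "z \<in> L" "z \<noteq> y"
    by blast
  \<comment> \<open>distinct vectors of coordinate sum zero are incomparable: the homothet of factor 0 is \<open>{y}\<close>\<close>
  have "\<exists>i. \<iota> z $ i < \<iota> y $ i"
  proof (rule ccontr)
    assume "\<nexists>i. \<iota> z $ i < \<iota> y $ i"
    then have "z \<in> (\<lambda>w. y + 0 *\<^sub>R w) ` regular_simplex \<iota>"
      by (simp add: mem_homothet_regular_simplex_iff[OF \<iota>] not_less del: scale_zero_left)
    with yz show False
      by auto
  qed
  then obtain i where "\<iota> z $ i < \<iota> y $ i" ..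
  then have "(INF y\<in>L. \<iota> y $ i) < \<iota> y $ i"
    using low_le[OF yz(1), of i] by linarith
  then have "(\<Sum>i\<in>UNIV. INF y\<in>L. \<iota> y $ i) < (\<Sum>i\<in>UNIV. \<iota> y $ i)"
    using low_le[OF \<open>y \<in> L\<close>] by (intro sum_strict_mono_ex1) auto
  then show ?thesis
    by (simp add: cover_factor_regular_simplex[OF \<iota> assms(2,3)] sum_zero)
qed

text \<open>
  Point reflection turns a cover of \<open>L\<close> by a homothet of \<open>- K\<close> into a cover of \<open>- L\<close> by a homothet
  of \<open>K\<close> with the opposite centre. Hence whatever is known about covering by \<open>\<Delta>\<close> carries over to
  \<open>- \<Delta>\<close>.
\<close>

lemma cover_factor_uminus_left:
  "cover_factor (uminus ` K) L = cover_factor K (uminus ` L)"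
proof -
  have *: "L \<subseteq> (\<lambda>y. x + r *\<^sub>R y) ` uminus ` K \<longleftrightarrow> uminus ` L \<subseteq> (\<lambda>y. - x + r *\<^sub>R y) ` K"
    for x :: 'a and r
  proof -
    have "(\<lambda>y. x + r *\<^sub>R y) ` uminus ` K = uminus ` (\<lambda>y. - x + r *\<^sub>R y) ` K"
      by (simp add: image_image)
    moreover have "A \<subseteq> uminus ` B \<longleftrightarrow> uminus ` A \<subseteq> B" for A B :: "'a set"
      by force
    ultimately show ?thesis
      by simp
  qed
  have "(\<exists>x. L \<subseteq> (\<lambda>y. x + r *\<^sub>R y) ` uminus ` K) \<longleftrightarrow>
        (\<exists>x. uminus ` L \<subseteq> (\<lambda>y. x + r *\<^sub>R y) ` K)" for r
    unfolding * by (metis minus_minus)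
  then show ?thesis
    by (simp add: cover_factor_def)
qed

section \<open>Additivity under Minkowski sums\<close>

lemma set_plus_nonempty: "A \<noteq> {} \<Longrightarrow> B \<noteq> {} \<Longrightarrow> A + B \<noteq> {}"
  using set_plus_intro by fastforce

lemma cINF_set_plus:
  fixes f :: "'a::ab_group_add \<Rightarrow> real"
  assumes add: "\<And>x y. f (x + y) = f x + f y"
    and "A \<noteq> {}" "B \<noteq> {}" "bdd_below (f ` A)" "bdd_below (f ` B)"
  shows "(INF x\<in>A + B. f x) = (INF x\<in>A. f x) + (INF x\<in>B. f x)"
proof (rule antisym)
  have bdd: "bdd_below (f ` (A + B))"
  proof -
    obtain a b where "\<And>x. x \<in> A \<Longrightarrow> a \<le> f x" "\<And>x. x \<in> B \<Longrightarrow> b \<le> f x"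
      using assms(4,5) by (auto simp: bdd_below_def)
    then show ?thesis
      by (intro bdd_belowI2[of _ "a + b"]) (auto elim!: set_plus_elim simp: add intro!: add_mono)
  qed
  have sum_le: "(INF x\<in>A + B. f x) \<le> f a + f b" if "a \<in> A" "b \<in> B" for a b
    using cINF_lower[OF bdd set_plus_intro[OF that]] by (simp add: add)
  have "(INF x\<in>A + B. f x) - f a \<le> (INF x\<in>B. f x)" if "a \<in> A" for a
    by (intro cINF_greatest assms) (use sum_le[OF that] in \<open>simp add: algebra_simps\<close>)
  then have "(INF x\<in>A + B. f x) - (INF x\<in>B. f x) \<le> (INF x\<in>A. f x)"
    by (intro cINF_greatest assms) (simp add: algebra_simps)
  then show "(INF x\<in>A + B. f x) \<le> (INF x\<in>A. f x) + (INF x\<in>B. f x)"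
    by linarith
next
  have "A + B \<noteq> {}"
    using assms by (intro set_plus_nonempty)
  then show "(INF x\<in>A. f x) + (INF x\<in>B. f x) \<le> (INF x\<in>A + B. f x)"
    by (intro cINF_greatest) (auto elim!: set_plus_elim simp: add intro!: add_mono cINF_lower assms)
qed

lemma bounded_set_plus:
  fixes A B :: "'a::real_normed_vector set"
  assumes "bounded A" "bounded B"
  shows "bounded (A + B)"
proof -
  have "A + B = (\<Union>x\<in>A. \<Union>y\<in>B. {x + y})"
    by (auto simp: set_plus_def)
  with bounded_sums[OF assms] show ?thesis
    by simp
qed

lemma cover_factor_regular_simplex_plus:
  fixes \<iota> :: "real ^ 'n \<Rightarrow> real ^ 'n option"
  assumes \<iota>: "hyperplane_identification \<iota>"
    and "A \<noteq> {}" "bounded A" "B \<noteq> {}" "bounded B"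
  shows "cover_factor (regular_simplex \<iota>) (A + B) =
           cover_factor (regular_simplex \<iota>) A + cover_factor (regular_simplex \<iota>) B"
proof -
  have lin: "linear \<iota>"
    using \<iota> by (simp add: hyperplane_identification_def)
  have "A + B \<noteq> {}" "bounded (A + B)"
    using assms by (simp_all add: set_plus_nonempty bounded_set_plus)
  then show ?thesis
    using assms
    by (simp add: cover_factor_regular_simplex cINF_set_plus bdd_below_linear_coordinate_image
        lin linear_add sum.distrib)
qed

lemma cover_factor_regular_simplex_sum:
  fixes \<iota> :: "real ^ 'n \<Rightarrow> real ^ 'n option"
  assumes \<iota>: "hyperplane_identification \<iota>" and "finite J"
    and "\<And>j. j \<in> J \<Longrightarrow> L j \<noteq> {}" "\<And>j. j \<in> J \<Longrightarrow> bounded (L j)"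
  shows "cover_factor (regular_simplex \<iota>) (\<Sum>j\<in>J. L j) =
           (\<Sum>j\<in>J. cover_factor (regular_simplex \<iota>) (L j))"
proof -
  have "(\<Sum>j\<in>J. L j) \<noteq> {} \<and> bounded (\<Sum>j\<in>J. L j) \<and>
        cover_factor (regular_simplex \<iota>) (\<Sum>j\<in>J. L j) =
          (\<Sum>j\<in>J. cover_factor (regular_simplex \<iota>) (L j))"
    using assms(2-)
  proof (induction J rule: finite_induct)
    case empty
    have "linear \<iota>"
      using \<iota> by (simp add: hyperplane_identification_def)
    then show ?case
      by (simp add: set_zero cover_factor_regular_simplex[OF \<iota>] linear_0)
  next
    case (insert j J)
    then have "L j + (\<Sum>j\<in>J. L j) \<noteq> {}" "bounded (L j + (\<Sum>j\<in>J. L j))"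
      by (simp_all add: set_plus_nonempty bounded_set_plus)
    with insert show ?case
      by (simp add: cover_factor_regular_simplex_plus[OF \<iota>])
  qed
  then show ?thesis
    by blast
qed

lemma uminus_image_set_sum:
  fixes L :: "'b \<Rightarrow> 'a::ab_group_add set"
  shows "uminus ` (\<Sum>j\<in>J. L j) = (\<Sum>j\<in>J. uminus ` L j)"
proof (induction J rule: infinite_finite_induct)
  case (insert j J)
  have "uminus ` (A + B) = uminus ` A + uminus ` B" for A B :: "'a set"
    by (force simp: set_plus_def)
  with insert show ?case
    by simp
qed (simp_all add: set_zero)

section \<open>The mediant inequality\<close>

lemma sum_divide_sum_le_Max:
  fixes a b :: "'i \<Rightarrow> real"
  assumes "finite J" "J \<noteq> {}" and pos: "\<And>j. j \<in> J \<Longrightarrow> b j > 0"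
  shows "(\<Sum>j\<in>J. a j) / (\<Sum>j\<in>J. b j) \<le> Max ((\<lambda>j. a j / b j) ` J)"
proof -
  let ?M = "Max ((\<lambda>j. a j / b j) ` J)"
  have "a j \<le> ?M * b j" if "j \<in> J" for j
  proof -
    have "a j / b j \<le> ?M"
      using assms that by simp
    then show ?thesis
      using pos[OF that] by (simp add: pos_divide_le_eq)
  qed
  then have "(\<Sum>j\<in>J. a j) \<le> ?M * (\<Sum>j\<in>J. b j)"
    unfolding sum_distrib_left by (rule sum_mono)
  moreover have "(\<Sum>j\<in>J. b j) > 0"
    using assms by (intro sum_pos)
  ultimately show ?thesis
    by (simp add: pos_divide_le_eq)
qed

theorem theorem9:
  fixes \<iota> :: "real ^ 'n \<Rightarrow> real ^ 'n option"
    and L :: "nat \<Rightarrow> (real ^ 'n) set"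
    and m :: nat
  assumes "hyperplane_identification \<iota>"
    and "m \<ge> 1"
    and "\<And>j. j \<in> {1..m} \<Longrightarrow> L j \<noteq> {}"
    and "\<And>j. j \<in> {1..m} \<Longrightarrow> compact (L j)"
    and "\<And>j. j \<in> {1..m} \<Longrightarrow> convex (L j)"
    and "\<And>j. j \<in> {1..m} \<Longrightarrow> \<not> is_singleton (L j)"
  shows "cover_ratio (regular_simplex \<iota>) (\<Sum>j\<in>{1..m}. L j)
           \<le> Max ((\<lambda>j. cover_ratio (regular_simplex \<iota>) (L j)) ` {1..m})"
proof -
  let ?J = "{1..m}"
  let ?S = "regular_simplex \<iota>"
  note \<iota> = assms(1)
  have bounded: "bounded (L j)" if "j \<in> ?J" for j
    using assms(4)[OF that] by (rule compact_imp_bounded)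
  have "cover_factor ?S (\<Sum>j\<in>?J. L j) = (\<Sum>j\<in>?J. cover_factor ?S (L j))"
    by (intro cover_factor_regular_simplex_sum \<iota> assms(3) bounded finite_atLeastAtMost)
  moreover have "cover_factor (uminus ` ?S) (\<Sum>j\<in>?J. L j) =
      (\<Sum>j\<in>?J. cover_factor (uminus ` ?S) (L j))"
    unfolding cover_factor_uminus_left uminus_image_set_sum
    by (intro cover_factor_regular_simplex_sum \<iota>)
      (use assms(3) bounded in \<open>auto simp: bounded_uminus\<close>)
  moreover have "cover_factor ?S (L j) > 0" if "j \<in> ?J" for j
    by (intro cover_factor_regular_simplex_pos \<iota> assms(3,6) bounded that)
  ultimately show ?thesis
    using assms(2) sum_divide_sum_le_Max[of ?J "\<lambda>j. cover_factor ?S (L j)"]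
    by (simp add: cover_ratio_def del: One_nat_def)
qed

end
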